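(* Let $N\ge 2$ and $r$ be integers with $1\le r\le \lfloor N/2\rfloor$. For every function $f:\mathbb{Z}/N\mathbb{Z}\to\mathbb{C}$, $$\|f*F_r\|_\infty \;\le\; \|f\|_2\,\|F_r\|_2 \;\le\; \sqrt{\tfrac{5}{3}}\; r^{-1/2}\,\|f\|_2 .$$
   Context: For $n\in\mathbb{Z}/N\mathbb{Z}$, $|n|$ denotes the absolute value of a representative of $n$ of least absolute value in $\{-\lfloor N/2\rfloor,\dots,\lfloor N/2\rfloor\}$. For integers $N\ge 2$ and $1\le r\le\lfloor N/2\rfloor$, the triangular kernel $F_r:\mathbb{Z}/N\mathbb{Z}\to[0,\infty)$ is $$F_r(n)=\frac1r\max\Bigl(0,\,1-\frac{|n|}{r}\Bigr).$$ For $f,g:\mathbb{Z}/N\mathbb{Z}\to\mathbb{C}$ the (circular, unnormalized) convolution is $(f*g)(n)=\sum_{m\in\mathbb{Z}/N\mathbb{Z}}f(n-m)g(m)$. Norms are with respect to counting measure: $\|f\|_2=\bigl(\sum_{n\in\mathbb{Z}/N\mathbb{Z}}|f(n)|^2\bigr)^{1/2}$ and $\|f\|_\infty=\max_{n\in\mathbb{Z}/N\mathbb{Z}}|f(n)|$. *)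

theory Defs
  imports "HOL-Analysis.Analysis" "HOL-Number_Theory.Residues"
begin

(* Z/NZ is the ring residue_ring N, whose carrier is {0..N-1}. A function on Z/NZ is a function on
   int of which only the values on this carrier are used. *)

definition ZMod :: "int \<Rightarrow> int set" where
  "ZMod N = carrier (residue_ring N)"

definition least_abs :: "int \<Rightarrow> int \<Rightarrow> int" where
  "least_abs N n = Min {\<bar>k\<bar> | k. k \<in> {- (N div 2)..N div 2} \<and> [k = n] (mod N)}"

definition tri_kernel :: "int \<Rightarrow> int \<Rightarrow> int \<Rightarrow> real" where
  "tri_kernel N r n = 1 / of_int r * max 0 (1 - of_int (least_abs N n) / of_int r)"

definition conv :: "int \<Rightarrow> (int \<Rightarrow> complex) \<Rightarrow> (int \<Rightarrow> complex) \<Rightarrow> int \<Rightarrow> complex" where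
  "conv N f g n = (\<Sum>m\<in>ZMod N. f (n \<ominus>\<^bsub>residue_ring N\<^esub> m) * g m)"

definition norm_2 :: "int \<Rightarrow> (int \<Rightarrow> complex) \<Rightarrow> real" where
  "norm_2 N f = L2_set (\<lambda>n. norm (f n)) (ZMod N)"

definition norm_inf :: "int \<Rightarrow> (int \<Rightarrow> complex) \<Rightarrow> real" where
  "norm_inf N f = Max ((\<lambda>n. norm (f n)) ` ZMod N)"

end

theory Submission
  imports Defs
begin

text \<open>
  The first inequality is Cauchy--Schwarz applied to the sum defining \<open>f * F\<^sub>r\<close> at one point \<open>n\<close>:
  the map \<open>m \<mapsto> n - m\<close> permutes \<open>\<int>/N\<int>\<close>, so the reflected translate of \<open>f\<close> has the same \<open>\<ell>\<^sup>2\<close>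
  norm as \<open>f\<close>.

  For the second, the kernel is nonnegative, is at most \<open>1/r\<close> everywhere, and has total mass at most
  \<open>1\<close>; hence \<open>\<Sum>F\<^sub>r\<^sup>2 \<le> (1/r) \<Sum>F\<^sub>r \<le> 1/r\<close>, which gives the claim even with \<open>1\<close> in place of
  \<open>sqrt (5/3)\<close>. The mass bound comes from viewing the kernel as two ramps on \<open>{0..<N}\<close>: one descends
  from \<open>0\<close>, the other ascends towards \<open>N\<close>, and their masses
  \<open>r (r + 1) / 2\<close> and \<open>r (r - 1) / 2\<close>, before normalisation by \<open>1/r\<^sup>2\<close>, add up to \<open>r\<^sup>2\<close>.
\<close>

lemma ZMod_eq: "ZMod N = {0..<N}"
  by (auto simp: ZMod_def residue_ring_def)

lemma residue_diff_eq:
  assumes "N \<ge> 2"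
  shows "n \<ominus>\<^bsub>residue_ring N\<^esub> m = (n - m) mod N"
proof -
  interpret residues N "residue_ring N"
    using assms by unfold_locales auto
  show ?thesis
    by (simp add: a_minus_def res_neg_eq res_add_eq mod_add_right_eq)
qed

lemma bij_betw_residue_reflect:
  assumes "N \<ge> 2"
  shows "bij_betw (\<lambda>m. n \<ominus>\<^bsub>residue_ring N\<^esub> m) (ZMod N) (ZMod N)"
proof -
  have "bij_betw (\<lambda>m. (n - m) mod N) {0..<N} {0..<N}"
  proof (rule bij_betw_byWitness[where f' = "\<lambda>m. (n - m) mod N"])
  qed (use assms in \<open>auto simp: mod_diff_right_eq\<close>)
  then show ?thesis
    by (simp only: residue_diff_eq[OF assms] ZMod_eq)
qed

lemma norm_conv_le:
  assumes "N \<ge> 2"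
  shows "norm (conv N f g n) \<le> norm_2 N f * norm_2 N g"
proof -
  let ?s = "\<lambda>m. n \<ominus>\<^bsub>residue_ring N\<^esub> m"
  have "norm (conv N f g n) \<le> (\<Sum>m\<in>ZMod N. \<bar>norm (f (?s m))\<bar> * \<bar>norm (g m)\<bar>)"
    unfolding conv_def by (rule sum_norm_le) (simp add: norm_mult)
  also have "\<dots> \<le> L2_set (\<lambda>m. norm (f (?s m))) (ZMod N) * norm_2 N g"
    unfolding norm_2_def by (rule L2_set_mult_ineq)
  also have "L2_set (\<lambda>m. norm (f (?s m))) (ZMod N) = norm_2 N f"
    unfolding norm_2_def L2_set_def
    using sum.reindex_bij_betw[OF bij_betw_residue_reflect[OF assms],
        where g = "\<lambda>m. (norm (f m))\<^sup>2"] by simp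
  finally show ?thesis .
qed

lemma norm_inf_conv_le:
  assumes "N \<ge> 2"
  shows "norm_inf N (conv N f g) \<le> norm_2 N f * norm_2 N g"
  unfolding norm_inf_def
  by (rule Max.boundedI) (use assms in \<open>auto simp: ZMod_eq norm_conv_le\<close>)

text \<open>
  A representative \<open>k = n + j N\<close> is at least \<open>n\<close> if \<open>j \<ge> 0\<close> and at most \<open>n - N\<close> otherwise, and one of
  \<open>n\<close>, \<open>n - N\<close> lies in the window, so that the minimum is over a nonempty set.
\<close>

lemma least_abs_ge:
  assumes "n \<in> {0..<N}"
  shows "min n (N - n) \<le> least_abs N n"
  unfolding least_abs_def
proof (rule Min.boundedI)
  let ?A = "{\<bar>k\<bar> | k. k \<in> {- (N div 2)..N div 2} \<and> [k = n] (mod N)}"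
  show "finite ?A"
    by (rule finite_subset[of _ "abs ` {- (N div 2)..N div 2}"]) auto
  show "?A \<noteq> {}"
  proof (cases "n \<le> N div 2")
    case True
    then have "\<bar>n\<bar> \<in> ?A" using assms by fastforce
    then show ?thesis by blast
  next
    case False
    have "[n - N = n] (mod N)" by (simp add: cong_def)
    moreover have "n - N \<in> {- (N div 2)..N div 2}" using False assms by auto
    ultimately have "\<bar>n - N\<bar> \<in> ?A" by blast
    then show ?thesis by blast
  qed
next
  fix a assume "a \<in> {\<bar>k\<bar> | k. k \<in> {- (N div 2)..N div 2} \<and> [k = n] (mod N)}"
  then obtain k where a: "a = \<bar>k\<bar>" and "[n = k] (mod N)" by (auto intro: cong_sym)
  then obtain j where k: "k = n + N * j" by (auto simp: cong_iff_lin)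
  show "min n (N - n) \<le> a"
  proof (cases "j \<ge> 0")
    case True
    then have "N * j \<ge> 0" using assms by simp
    then show ?thesis using a k by linarith
  next
    case False
    then have "N * j \<le> N * (- 1)" using assms by (intro mult_left_mono) auto
    then show ?thesis using a k by linarith
  qed
qed

lemma tri_kernel_nonneg: "r \<ge> 1 \<Longrightarrow> 0 \<le> tri_kernel N r n"
  by (simp add: tri_kernel_def)

lemma tri_kernel_le_inverse:
  assumes "r \<ge> 1" and "n \<in> {0..<N}"
  shows "tri_kernel N r n \<le> 1 / real_of_int r"
proof -
  have "0 \<le> least_abs N n" using least_abs_ge[OF assms(2)] assms(2) by auto
  then show ?thesis using assms(1) by (simp add: tri_kernel_def divide_right_mono)
qed

lemma sum_ramp:
  assumes "0 \<le> r" and "r \<le> N"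
  shows "2 * (\<Sum>n\<in>{0..<N}. max 0 (r - n)) = r * (r + 1 :: int)"
proof -
  have "(\<Sum>n\<in>{0..<N}. max 0 (r - n)) = (\<Sum>n\<in>{0..<r}. r - n)"
    by (rule sum.mono_neutral_cong_right) (use assms in auto)
  moreover have "2 * (\<Sum>n\<in>{0..<r}. r - n) = r * (r + 1)"
    using assms(1)
  proof (induction r rule: int_ge_induct)
    case base
    show ?case by simp
  next
    case (step i)
    have "{0..<i + 1} = insert i {0..<i}" using step by auto
    then have "(\<Sum>n\<in>{0..<i + 1}. i + 1 - n) = 1 + (\<Sum>n\<in>{0..<i}. (i - n) + 1)"
      by (simp add: algebra_simps)
    also have "\<dots> = 1 + (\<Sum>n\<in>{0..<i}. i - n) + i"
      using step by (simp only: sum.distrib) simp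
    finally show ?case using step by (simp add: algebra_simps)
  qed
  ultimately show ?thesis by simp
qed

text \<open>
  Both ramps have the shape of the previous lemma. The ascending one, read backwards from \<open>N - 1\<close>,
  starts one step below the peak, and so is the descending ramp of height \<open>r - 1\<close>.
\<close>

lemma sum_tri_kernel_le_1:
  assumes "1 \<le> r" and "r \<le> N"
  shows "(\<Sum>n\<in>{0..<N}. tri_kernel N r n) \<le> 1"
proof -
  let ?d = "\<lambda>n. max 0 (r - n)" and ?u = "\<lambda>n. max 0 (r - (N - n))"
  have le: "tri_kernel N r n \<le> real_of_int (?d n + ?u n) / (real_of_int r)\<^sup>2"
    if "n \<in> {0..<N}" for n
  proof -
    have "tri_kernel N r n = real_of_int (max 0 (r - least_abs N n)) / (real_of_int r)\<^sup>2"
      using assms by (simp add: tri_kernel_def power2_eq_square max_def field_simps)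
    moreover have "max 0 (r - least_abs N n) \<le> ?d n + ?u n"
      using least_abs_ge[OF that] by linarith
    ultimately show ?thesis by (simp only: divide_right_mono of_int_le_iff zero_le_power2)
  qed
  have "(\<Sum>n\<in>{0..<N}. ?u n) = (\<Sum>m\<in>{0..<N}. max 0 (r - 1 - m))"
    by (rule sum.reindex_bij_witness[of _ "\<lambda>m. N - 1 - m" "\<lambda>n. N - 1 - n"]) auto
  moreover have "2 * (\<Sum>m\<in>{0..<N}. max 0 (r - 1 - m)) = (r - 1) * r"
    using sum_ramp[of "r - 1" N] assms by simp
  moreover have "2 * (\<Sum>n\<in>{0..<N}. ?d n) = r * (r + 1)"
    using sum_ramp[of r N] assms by simp
  ultimately have mass: "(\<Sum>n\<in>{0..<N}. ?d n + ?u n) = r\<^sup>2"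
    unfolding sum.distrib power2_eq_square by (simp add: algebra_simps)
  have "(\<Sum>n\<in>{0..<N}. tri_kernel N r n)
      \<le> (\<Sum>n\<in>{0..<N}. real_of_int (?d n + ?u n) / (real_of_int r)\<^sup>2)"
    by (rule sum_mono) (rule le)
  also have "\<dots> = real_of_int (\<Sum>n\<in>{0..<N}. ?d n + ?u n) / (real_of_int r)\<^sup>2"
    by (simp only: of_int_sum sum_divide_distrib)
  also have "\<dots> = 1"
    using assms(1) unfolding mass by simp
  finally show ?thesis .
qed

text \<open>Interpolation between the sup norm \<open>1/r\<close> and the \<open>\<ell>\<^sup>1\<close> norm \<open>1\<close>.\<close>

lemma norm_2_tri_kernel_le:
  assumes "1 \<le> r" and "r \<le> N"
  shows "norm_2 N (\<lambda>n. complex_of_real (tri_kernel N r n)) \<le> real_of_int r powr (- 1 / 2)"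
proof -
  have "(\<Sum>n\<in>{0..<N}. (tri_kernel N r n)\<^sup>2)
      \<le> (\<Sum>n\<in>{0..<N}. 1 / real_of_int r * tri_kernel N r n)"
    unfolding power2_eq_square
    by (intro sum_mono mult_right_mono tri_kernel_le_inverse tri_kernel_nonneg) (use assms in auto)
  also have "\<dots> = 1 / real_of_int r * (\<Sum>n\<in>{0..<N}. tri_kernel N r n)"
    by (simp only: sum_distrib_left)
  also have "\<dots> \<le> 1 / real_of_int r * 1"
    by (intro mult_left_mono sum_tri_kernel_le_1) (use assms in auto)
  finally have "sqrt (\<Sum>n\<in>{0..<N}. (tri_kernel N r n)\<^sup>2) \<le> sqrt (1 / real_of_int r)"
    by simp
  also have "\<dots> = real_of_int r powr (- 1 / 2)"
    using assms(1) by (simp add: powr_minus_divide powr_half_sqrt real_sqrt_divide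
        flip: minus_divide_left)
  finally show ?thesis
    by (simp add: norm_2_def L2_set_def ZMod_eq)
qed

theorem theorem5p1:
  fixes N r :: int and f :: "int \<Rightarrow> complex"
  assumes "N \<ge> 2" and "1 \<le> r" and "r \<le> \<lfloor>real_of_int N / 2\<rfloor>"
  defines "F \<equiv> (\<lambda>n. complex_of_real (tri_kernel N r n))"
  shows "norm_inf N (conv N f F) \<le> norm_2 N f * norm_2 N F
       \<and> norm_2 N f * norm_2 N F \<le> sqrt (5 / 3) * real_of_int r powr (- 1 / 2) * norm_2 N f"
proof
  show "norm_inf N (conv N f F) \<le> norm_2 N f * norm_2 N F"
    using assms(1) by (rule norm_inf_conv_le)
next
  have "r \<le> N"
    using assms(1,3) by linarith
  then have "norm_2 N F \<le> 1 * real_of_int r powr (- 1 / 2)"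
    unfolding F_def using norm_2_tri_kernel_le[OF assms(2)] by simp
  also have "\<dots> \<le> sqrt (5 / 3) * real_of_int r powr (- 1 / 2)"
    by (rule mult_right_mono) auto
  finally have "norm_2 N F * norm_2 N f \<le> sqrt (5 / 3) * real_of_int r powr (- 1 / 2) * norm_2 N f"
    by (rule mult_right_mono) (simp add: norm_2_def)
  then show "norm_2 N f * norm_2 N F \<le> sqrt (5 / 3) * real_of_int r powr (- 1 / 2) * norm_2 N f"
    by (simp only: mult.commute)
qed

end
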